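(* Let $(X_n)_{n \geqslant 1}$ be a sequence of independent and identically distributed real valued random variables, and for $n \geqslant 1$ let $\overline{X}_n = \frac{1}{n} \sum_{i=1}^n X_i$ be the empirical mean. Then for all $x \in \mathbb{R}$ the sequence $$\frac{1}{n} \log \mathbb{P}\big( \overline{X}_n \geqslant x\big), \qquad n \geqslant 1,$$ converges in $[-\infty , 0]$ and $$\lim_{n\to\infty} \frac{1}{n} \log \mathbb{P}\big( \overline{X}_n \geqslant x\big) = \inf_{\lambda \geqslant 0} \Big( \log \mathbb{E} \big( e^{\lambda X_1} \big) - \lambda x \Big).$$
   Context: No integrability is assumed on $X_1$. The expectation $\mathbb{E}(e^{\lambda X_1})$ takes values in $]0,+\infty]$, with the conventions $\log(+\infty)=+\infty$ and $\log 0 = -\infty$. Limits and infima are taken in the extended real line $[-\infty,+\infty]$, and the infimum is over all real $\lambda \geqslant 0$. *)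

theory Defs
  imports "HOL-Probability.Probability"
begin

definition ext_log :: "ennreal \<Rightarrow> ereal" where
  "ext_log p = (if p = 0 then -\<infinity> else if p = \<infinity> then \<infinity> else ereal (ln (enn2real p)))"

(* The sample starts at index 1; the value at n = 0 is the junk value 0. *)
definition empirical_mean :: "(nat \<Rightarrow> 'a \<Rightarrow> real) \<Rightarrow> nat \<Rightarrow> 'a \<Rightarrow> real" where
  "empirical_mean X n \<omega> = (1 / real n) * (\<Sum>i=1..n. X i \<omega>)"

end

theory Submission
  imports Defs
begin

text \<open>
  Put \<open>Y i = X i - x\<close>, let \<open>\<mu>\<close> be the common law, \<open>S n\<close> the sum of the first \<open>n\<close> terms and
  \<open>E l\<close> the integral of \<open>exp (l y)\<close> against \<open>\<mu>\<close>. The event is \<open>S n \<ge> 0\<close>, and the claimed limit is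
  the infimum of \<open>log (E l)\<close> over \<open>l \<ge> 0\<close>. The upper bound is Chernoff's inequality
  (\<open>chernoff_sum\<close>), valid for every \<open>n\<close>; hence only a lower bound for large \<open>n\<close> is missing, and
  it suffices to show that \<open>0 < r < E l\<close> for all \<open>l \<ge> 0\<close> implies \<open>P (S n \<ge> 0) \<ge> r ^ n\<close> eventually
  (\<open>lower_bound_sum\<close>).

  If \<open>\<mu>\<close> does not charge the positive half-line, \<open>E l\<close> decreases to the mass of the atom at
  \<open>0\<close>, and the event that all \<open>Y i\<close> vanish is likely enough (\<open>atom_at_zero_ge\<close>,
  \<open>atom_power_le\<close>). Otherwise \<open>\<mu>\<close> is truncated to a window \<open>[-K, K]\<close>. The truncated
  integrals grow exponentially in \<open>l\<close>, so compactness provides one \<open>K\<close> that keeps them above \<open>r\<close>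
  for all \<open>l \<ge> 0\<close> simultaneously (\<open>truncation_uniform\<close>).

  For a fixed \<open>K\<close>, write \<open>m\<close> for the truncated moment generating function. The usual change of
  measure followed by a law of large numbers is replaced by the pointwise inequality, for
  \<open>0 \<le> \<alpha> \<le> \<beta> \<le> \<gamma>\<close> and real \<open>s\<close>, \<open>t\<close>,

  \<open>exp (\<beta> (s - t)) \<le> 1[s \<ge> 0] + exp (\<alpha> s - \<beta> t) + exp (\<gamma> (s - t))\<close>.

  With \<open>s = S n\<close> and \<open>t = n b\<close>, independence turns the three exponentials into \<open>n\<close>-th powers
  (\<open>tilted_lower_bound\<close>). The two error terms are exponentially negligible as soon as
  \<open>m \<alpha> < m \<beta>\<close> and \<open>m \<gamma> < exp ((\<gamma> - \<beta>) b) m \<beta>\<close>: informally, \<open>log m\<close> increases up to \<open>\<beta>\<close> and has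
  slope less than \<open>b\<close> beyond it. Such parameters exist slightly to the right of the minimizer of
  \<open>m\<close> on the half-line (\<open>exists_tilt\<close>), with \<open>\<beta> b\<close> so small that the factor \<open>exp (- \<beta> b)\<close>
  preserves the bound \<open>r\<close>.
\<close>

section \<open>Truncated moment generating functions\<close>

definition trunc_mgf :: "real measure \<Rightarrow> real \<Rightarrow> real \<Rightarrow> real" where
  "trunc_mgf \<mu> K l = (\<integral>y. indicator {-K..K} y * exp (l * y) \<partial>\<mu>)"

context real_distribution
begin

lemma integrable_trunc_exp: "integrable M (\<lambda>y. indicator {-K..K} y * exp (l * y) :: real)"
proof (rule integrable_const_bound[where B = "exp (\<bar>l\<bar> * \<bar>K\<bar>)"])
  show "AE y in M. norm (indicator {-K..K} y * exp (l * y)) \<le> exp (\<bar>l\<bar> * \<bar>K\<bar>)"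
  proof (rule AE_I2)
    fix y
    have "l * y \<le> \<bar>l\<bar> * \<bar>K\<bar>" if "y \<in> {-K..K}"
    proof -
      have "l * y \<le> \<bar>l\<bar> * \<bar>y\<bar>" by (metis abs_ge_self abs_mult)
      also have "\<dots> \<le> \<bar>l\<bar> * \<bar>K\<bar>" using that by (intro mult_left_mono) auto
      finally show ?thesis .
    qed
    then show "norm (indicator {-K..K} y * exp (l * y)) \<le> exp (\<bar>l\<bar> * \<bar>K\<bar>)"
      by (auto simp: indicator_def)
  qed
qed simp

lemma nn_integral_trunc_exp:
  "(\<integral>\<^sup>+y. ennreal (indicator {-K..K} y * exp (l * y)) \<partial>M) = ennreal (trunc_mgf M K l)"
  unfolding trunc_mgf_def by (rule nn_integral_eq_integral[OF integrable_trunc_exp]) simp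

lemma trunc_mgf_mono:
  assumes "K \<le> K'"
  shows "trunc_mgf M K l \<le> trunc_mgf M K' l"
  unfolding trunc_mgf_def using assms
  by (intro integral_mono integrable_trunc_exp) (auto simp: indicator_def)

lemma trunc_mgf_add_le: "trunc_mgf M K (l + h) \<le> exp (\<bar>h\<bar> * K) * trunc_mgf M K l"
proof -
  have "trunc_mgf M K (l + h) \<le> (\<integral>y. exp (\<bar>h\<bar> * K) * (indicator {-K..K} y * exp (l * y)) \<partial>M)"
    unfolding trunc_mgf_def
  proof (intro integral_mono integrable_trunc_exp integrable_mult_right)
    fix y
    have "h * y \<le> \<bar>h\<bar> * K" if "y \<in> {-K..K}"
    proof -
      have "h * y \<le> \<bar>h\<bar> * \<bar>y\<bar>" by (metis abs_ge_self abs_mult)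
      also have "\<dots> \<le> \<bar>h\<bar> * K" using that by (intro mult_left_mono) auto
      finally show ?thesis .
    qed
    then show "indicator {-K..K} y * exp ((l + h) * y) \<le> exp (\<bar>h\<bar> * K) * (indicator {-K..K} y * exp (l * y))"
      by (auto simp: indicator_def exp_add[symmetric] algebra_simps)
  qed
  then show ?thesis by (simp add: trunc_mgf_def)
qed

lemma continuous_trunc_mgf: "continuous_on S (trunc_mgf M K)"
proof (rule continuous_at_imp_continuous_on, rule ballI)
  fix l
  have up: "trunc_mgf M K m \<le> exp (\<bar>m - l\<bar> * K) * trunc_mgf M K l" for m
    using trunc_mgf_add_le[of K l "m - l"] by simp
  have lo: "exp (- (\<bar>m - l\<bar> * K)) * trunc_mgf M K l \<le> trunc_mgf M K m" for m
  proof -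
    have "exp (- (\<bar>m - l\<bar> * K)) * trunc_mgf M K l
        \<le> exp (- (\<bar>m - l\<bar> * K)) * (exp (\<bar>l - m\<bar> * K) * trunc_mgf M K m)"
      using trunc_mgf_add_le[of K m "l - m"] by (intro mult_left_mono) auto
    also have "\<dots> = trunc_mgf M K m"
      by (simp add: mult.assoc[symmetric] exp_add[symmetric] abs_minus_commute)
    finally show ?thesis .
  qed
  have "((\<lambda>m. exp (- (\<bar>m - l\<bar> * K)) * trunc_mgf M K l) \<longlongrightarrow> exp (- (\<bar>l - l\<bar> * K)) * trunc_mgf M K l) (at l)"
    by (intro tendsto_intros)
  moreover have "((\<lambda>m. exp (\<bar>m - l\<bar> * K) * trunc_mgf M K l) \<longlongrightarrow> exp (\<bar>l - l\<bar> * K) * trunc_mgf M K l) (at l)"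
    by (intro tendsto_intros)
  ultimately show "isCont (trunc_mgf M K) l"
    unfolding isCont_def
    using tendsto_sandwich[of "\<lambda>m. exp (- (\<bar>m - l\<bar> * K)) * trunc_mgf M K l" "trunc_mgf M K" "at l"
          "\<lambda>m. exp (\<bar>m - l\<bar> * K) * trunc_mgf M K l" "trunc_mgf M K l"] up lo
    by simp
qed

lemma trunc_mgf_ge_exp:
  assumes "0 < a" "0 \<le> l"
  shows "prob {a..K} * exp (l * a) \<le> trunc_mgf M K l"
proof -
  have "(\<integral>y. indicator {a..K} y * exp (l * a) \<partial>M) \<le> trunc_mgf M K l"
    unfolding trunc_mgf_def
  proof (intro integral_mono integrable_trunc_exp)
    show "integrable M (\<lambda>y. indicator {a..K} y * exp (l * a) :: real)"
      by (intro integrable_mult_left) (simp add: integrable_indicator_iff emeasure_eq_measure)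
    show "indicator {a..K} y * exp (l * a) \<le> indicator {-K..K} y * exp (l * y)" for y
      using assms by (auto simp: indicator_def mult_left_mono)
  qed
  then show ?thesis by simp
qed

text \<open>
  Strict convexity, from \<open>exp (l y) + exp ((l + 2 h) y) - 2 exp ((l + h) y) = exp (l y) (exp (h y) - 1)\<^sup>2\<close>.
  It makes the function strictly exceed its minimum at every point to the right of a minimizer.
\<close>

lemma trunc_mgf_midpoint:
  assumes "0 < a" "0 < prob {a..K}" "0 \<le> l" "0 < h"
  shows "2 * trunc_mgf M K (l + h) < trunc_mgf M K l + trunc_mgf M K (l + 2 * h)"
proof -
  note I = integrable_trunc_exp
  have "(\<integral>y. indicator {a..K} y * (exp (h * a) - 1)^2 \<partial>M)
    \<le> (\<integral>y. indicator {-K..K} y * exp (l * y) + indicator {-K..K} y * exp ((l + 2 * h) * y)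
         - 2 * (indicator {-K..K} y * exp ((l + h) * y)) \<partial>M)"
  proof (intro integral_mono Bochner_Integration.integrable_diff Bochner_Integration.integrable_add integrable_mult_right I)
    show "integrable M (\<lambda>y. indicator {a..K} y * (exp (h * a) - 1)^2 :: real)"
      by (intro integrable_mult_left) (simp add: integrable_indicator_iff emeasure_eq_measure)
    fix y :: real
    have sq: "exp (l * y) + exp ((l + 2 * h) * y) - 2 * exp ((l + h) * y)
        = exp (l * y) * (exp (h * y) - 1)^2"
      by (simp add: power2_eq_square exp_double[symmetric] algebra_simps exp_add[symmetric])
    have "1 * (exp (h * a) - 1)^2 \<le> exp (l * y) * (exp (h * y) - 1)^2" if "y \<in> {a..K}"
      using that assms by (intro mult_mono power_mono) (auto simp: mult_left_mono)
    moreover have "0 \<le> exp (l * y) * (exp (h * y) - 1)^2" by simp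
    ultimately show "indicator {a..K} y * (exp (h * a) - 1)^2
      \<le> indicator {-K..K} y * exp (l * y) + indicator {-K..K} y * exp ((l + 2 * h) * y)
         - 2 * (indicator {-K..K} y * exp ((l + h) * y))"
      using assms(1) unfolding sq[symmetric] by (auto simp: indicator_def)
  qed
  also have "\<dots> = trunc_mgf M K l + trunc_mgf M K (l + 2 * h) - 2 * trunc_mgf M K (l + h)"
    unfolding trunc_mgf_def by (simp add: I)
  finally have "prob {a..K} * (exp (h * a) - 1)^2
      \<le> trunc_mgf M K l + trunc_mgf M K (l + 2 * h) - 2 * trunc_mgf M K (l + h)"
    by simp
  moreover have "0 < prob {a..K} * (exp (h * a) - 1)^2"
    using assms by simp
  ultimately show ?thesis by linarith
qed

text \<open>
  Substitute for a second derivative bound: if \<open>l\<close> is a minimizer, the term at \<open>l - h\<close> is at least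
  the value at \<open>l\<close>, so the increase from \<open>l\<close> to \<open>l + h\<close> is at most \<open>2 cosh (h K) - 2\<close> times that
  value, which is of second order in \<open>h\<close>. No differentiation under the integral is involved.
\<close>

lemma trunc_mgf_symmetric_le:
  "trunc_mgf M K (l + h) + trunc_mgf M K (l - h) \<le> 2 * cosh (h * K) * trunc_mgf M K l"
proof -
  note I = integrable_trunc_exp
  have "trunc_mgf M K (l + h) + trunc_mgf M K (l - h) =
    (\<integral>y. indicator {-K..K} y * exp ((l + h) * y) + indicator {-K..K} y * exp ((l - h) * y) \<partial>M)"
    unfolding trunc_mgf_def by (simp add: I)
  also have "\<dots> \<le> (\<integral>y. 2 * cosh (h * K) * (indicator {-K..K} y * exp (l * y)) \<partial>M)"
  proof (intro integral_mono Bochner_Integration.integrable_add integrable_mult_right I)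
    fix y :: real
    have eq: "exp ((l + h) * y) + exp ((l - h) * y) = 2 * cosh (h * y) * exp (l * y)"
      by (simp add: cosh_def algebra_simps exp_add exp_diff exp_minus field_simps)
    have "cosh (h * y) \<le> cosh (h * K)" if "y \<in> {-K..K}"
    proof -
      have "cosh \<bar>h * y\<bar> \<le> cosh \<bar>h * K\<bar>"
        using that by (subst cosh_real_nonneg_le_iff) (auto simp: abs_mult mult_left_mono)
      then show ?thesis by (simp add: cosh_real_abs)
    qed
    then show "indicator {-K..K} y * exp ((l + h) * y) + indicator {-K..K} y * exp ((l - h) * y)
      \<le> 2 * cosh (h * K) * (indicator {-K..K} y * exp (l * y))"
      using eq by (auto simp: indicator_def)
  qed
  also have "\<dots> = 2 * cosh (h * K) * trunc_mgf M K l"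
    by (simp add: trunc_mgf_def)
  finally show ?thesis .
qed

text \<open>
  Mass on \<open>[a, K0]\<close> forces at least linear growth in \<open>l\<close>. The bound does not depend on \<open>K\<close>, so that
  the sublevel sets of all larger windows lie in one compact interval.
\<close>

lemma bounded_sublevel_trunc_mgf:
  assumes "0 < a" "0 < prob {a..K0}" 
  obtains L where "0 \<le> L" "\<And>K l. \<lbrakk>K0 \<le> K; 0 \<le> l; trunc_mgf M K l \<le> r\<rbrakk> \<Longrightarrow> l \<le> L"
proof
  let ?c = "prob {a..K0}"
  let ?L = "\<bar>r\<bar> / (?c * a)"
  show "0 \<le> ?L" using assms by simp
  fix K l :: real
  assume K: "K0 \<le> K" and l: "0 \<le> l" and le: "trunc_mgf M K l \<le> r"
  have "?c * (l * a) \<le> ?c * exp (l * a)"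
    using exp_ge_add_one_self[of "l * a"] assms by (intro mult_left_mono) linarith+
  also have "\<dots> \<le> trunc_mgf M K0 l" using trunc_mgf_ge_exp[OF assms(1) l] .
  also have "\<dots> \<le> trunc_mgf M K l" using trunc_mgf_mono[OF K] .
  also have "\<dots> \<le> \<bar>r\<bar>" using le by linarith
  finally show "l \<le> ?L" using assms by (simp add: field_simps)
qed

lemma trunc_mgf_minimizer:
  assumes "0 < a" "0 < prob {a..K}"
  obtains l0 where "0 \<le> l0" "\<And>l. 0 \<le> l \<Longrightarrow> trunc_mgf M K l0 \<le> trunc_mgf M K l"
proof -
  obtain L where L: "0 \<le> L" "\<And>l. \<lbrakk>0 \<le> l; trunc_mgf M K l \<le> trunc_mgf M K 0\<rbrakk> \<Longrightarrow> l \<le> L"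
    by (rule bounded_sublevel_trunc_mgf[OF assms, of "trunc_mgf M K 0"]) auto
  obtain l0 where l0: "l0 \<in> {0..L}" "\<And>l. l \<in> {0..L} \<Longrightarrow> trunc_mgf M K l0 \<le> trunc_mgf M K l"
    using continuous_attains_inf[of "{0..L}" "trunc_mgf M K"] L(1) continuous_trunc_mgf by force
  show thesis
  proof
    show "0 \<le> l0" using l0 by simp
    fix l :: real assume l: "0 \<le> l"
    show "trunc_mgf M K l0 \<le> trunc_mgf M K l"
    proof (cases "l \<le> L")
      case True then show ?thesis using l0 l by simp
    next
      case False
      then have "trunc_mgf M K 0 \<le> trunc_mgf M K l" using L(2)[OF l] by linarith
      then show ?thesis using l0(2)[of 0] L(1) by simp
    qed
  qed
qed

text \<open>
  Let \<open>l0\<close> be a minimizer on the half-line. If \<open>l0 > 0\<close>, the function is flat to first order at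
  \<open>l0\<close>, so an arbitrarily small slope \<open>b\<close> is affordable on \<open>[l0 + h, l0 + 2 h]\<close>. If \<open>l0 = 0\<close> the slope
  there may be positive; then \<open>b = K + 1\<close> exceeds every possible slope of the logarithm, and the
  cost \<open>\<beta> b\<close> is small because \<open>\<beta> = h\<close> is.
\<close>

lemma exists_tilt:
  assumes a: "0 < a" and c: "0 < prob {a..K}" and r: "0 < r"
    and less: "\<And>l. 0 \<le> l \<Longrightarrow> r < trunc_mgf M K l"
  obtains \<alpha> \<beta> \<gamma> b where "0 \<le> \<alpha>" "\<alpha> \<le> \<beta>" "\<beta> \<le> \<gamma>"
    "r < exp (- (\<beta> * b)) * trunc_mgf M K \<beta>"
    "exp (- (\<beta> * b)) * trunc_mgf M K \<alpha> < exp (- (\<beta> * b)) * trunc_mgf M K \<beta>"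
    "exp (- (\<gamma> * b)) * trunc_mgf M K \<gamma> < exp (- (\<beta> * b)) * trunc_mgf M K \<beta>"
proof -
  let ?m = "trunc_mgf M K"
  obtain l0 where l0: "0 \<le> l0" "\<And>l. 0 \<le> l \<Longrightarrow> ?m l0 \<le> ?m l"
    using trunc_mgf_minimizer[OF a c] by metis
  have rm: "r < ?m l0" "0 < ?m l0" using less[OF l0(1)] r by auto
  have strict: "?m l0 < ?m (l0 + h)" if "0 < h" for h
    using trunc_mgf_midpoint[OF a c l0(1), of "h / 2"] l0(2)[of "l0 + h / 2"] l0(1) that by auto
  have small: "\<exists>d>0. \<forall>h. 0 < h \<and> h < d \<longrightarrow> r < exp (- ((l0' + h) * b)) * ?m l0"
    if "exp (- (l0' * b)) * ?m l0 > r" for l0' b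
  proof -
    have "((\<lambda>h. exp (- ((l0' + h) * b)) * ?m l0) \<longlongrightarrow> exp (- ((l0' + 0) * b)) * ?m l0) (at_right 0)"
      by (intro tendsto_intros)
    then have "eventually (\<lambda>h. r < exp (- ((l0' + h) * b)) * ?m l0) (at_right 0)"
      using that by (intro order_tendstoD(1)[of _ _ "at_right 0"]) auto
    then show ?thesis by (auto simp: eventually_at_right_field)
  qed
  have scale: "r < exp (- ((l0 + h) * b)) * ?m (l0 + h)"
    if "r < exp (- ((l0 + h) * b)) * ?m l0" "0 < h" for h b
    using that strict[of h] by (smt (verit) exp_gt_zero mult_le_cancel_left_pos)
  show thesis
  proof (cases "l0 = 0")
    case True
    \<comment> \<open>By \<open>trunc_mgf_add_le\<close>, a step of length \<open>1\<close> multiplies the function by at most \<open>exp K\<close>.\<close>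
    obtain d where d: "d > 0" "\<And>h. 0 < h \<and> h < d \<Longrightarrow> r < exp (- ((0 + h) * (K + 1))) * ?m l0"
      using small[of 0 "K + 1"] rm by auto
    define h where "h = d / 2"
    have h: "0 < h" "h < d" using d(1) by (auto simp: h_def)
    show thesis
    proof (rule that[of 0 h "h + 1" "K + 1"])
      show "r < exp (- (h * (K + 1))) * ?m h"
        using scale[of h "K + 1"] d(2)[of h] h True by simp
      show "exp (- (h * (K + 1))) * ?m 0 < exp (- (h * (K + 1))) * ?m h"
        using strict[of h] h True by simp
      have pos: "0 < ?m h" using less[of h] r h by simp
      have "exp (- ((h + 1) * (K + 1))) * ?m (h + 1)
          \<le> exp (- ((h + 1) * (K + 1))) * (exp K * ?m h)"
        using trunc_mgf_add_le[of K h 1] by (intro mult_left_mono) auto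
      also have "\<dots> = exp (- ((h + 1) * (K + 1)) + K) * ?m h"
        by (simp only: exp_add mult.assoc)
      also have "- ((h + 1) * (K + 1)) + K = - (h * (K + 1)) - 1"
        by (simp add: algebra_simps)
      also have "exp (- (h * (K + 1)) - 1) * ?m h < exp (- (h * (K + 1))) * ?m h"
        using pos by simp
      finally show "exp (- ((h + 1) * (K + 1))) * ?m (h + 1) < exp (- (h * (K + 1))) * ?m h" .
    qed (use h in auto)
  next
    case False
    then have l0pos: "0 < l0" using l0(1) by simp
    obtain b where b: "0 < b" "r < exp (- (l0 * b)) * ?m l0"
    proof -
      have "((\<lambda>b. exp (- (l0 * b)) * ?m l0) \<longlongrightarrow> exp (- (l0 * 0)) * ?m l0) (at_right 0)"
        by (intro tendsto_intros)
      then have "eventually (\<lambda>b. r < exp (- (l0 * b)) * ?m l0) (at_right 0)"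
        using rm by (intro order_tendstoD(1)[of _ _ "at_right 0"]) auto
      then obtain d where d: "d > 0" "\<forall>y>0. y < d \<longrightarrow> r < exp (- (l0 * y)) * ?m l0"
        by (auto simp: eventually_at_right_field)
      show thesis using that[of "d / 2"] d(1) d(2)[rule_format, of "d / 2"] by simp
    qed
    obtain d1 where d1: "d1 > 0" "\<And>h. 0 < h \<and> h < d1 \<Longrightarrow> r < exp (- ((l0 + h) * b)) * ?m l0"
      using small[OF b(2)] by auto
    \<comment> \<open>\<open>f 0 = 0\<close> and \<open>f' 0 = b > 0\<close>: the exponential beats the second-order increase over \<open>2 h\<close>.\<close>
    define f where "f = (\<lambda>h. exp (h * b) - 2 * cosh (2 * h * K) + 1)"
    have "(f has_real_derivative b) (at 0)"
      unfolding f_def by (auto intro!: derivative_eq_intros)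
    then obtain d2 where d2: "d2 > 0" "\<And>h. 0 < h \<Longrightarrow> h < d2 \<Longrightarrow> f 0 < f (0 + h)"
      using DERIV_pos_inc_right[of f b 0] b(1) by blast
    define h where "h = min (min d1 d2) l0 / 2"
    have h: "0 < h" "h < d1" "h < d2" "2 * h \<le> l0"
      using d1(1) d2(1) l0pos by (auto simp: h_def)
    show thesis
    proof (rule that[of l0 "l0 + h" "l0 + 2 * h" b])
      show "r < exp (- ((l0 + h) * b)) * ?m (l0 + h)"
        using scale[of h b] d1(2)[of h] h by simp
      show "exp (- ((l0 + h) * b)) * ?m l0 < exp (- ((l0 + h) * b)) * ?m (l0 + h)"
        using strict[of h] h by simp
      have "?m (l0 + 2 * h) + ?m l0 \<le> 2 * cosh (2 * h * K) * ?m l0"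
        using trunc_mgf_symmetric_le[of K l0 "2 * h"] l0(2)[of "l0 - 2 * h"] h by simp
      moreover have "2 * cosh (2 * h * K) - 1 < exp (h * b)"
        using d2(2)[of h] h by (simp add: f_def)
      then have "(2 * cosh (2 * h * K) - 1) * ?m l0 < exp (h * b) * ?m l0"
        using rm by simp
      ultimately have "?m (l0 + 2 * h) < exp (h * b) * ?m l0"
        by (simp add: algebra_simps)
      also have "\<dots> \<le> exp (h * b) * ?m (l0 + h)"
        using strict[of h] h by simp
      finally have "exp (- ((l0 + 2 * h) * b)) * ?m (l0 + 2 * h)
          < exp (- ((l0 + 2 * h) * b)) * (exp (h * b) * ?m (l0 + h))"
        by simp
      also have "\<dots> = exp (- ((l0 + 2 * h) * b) + h * b) * ?m (l0 + h)"
        by (simp only: exp_add mult.assoc)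
      also have "- ((l0 + 2 * h) * b) + h * b = - ((l0 + h) * b)"
        by (simp add: algebra_simps)
      finally show "exp (- ((l0 + 2 * h) * b)) * ?m (l0 + 2 * h)
          < exp (- ((l0 + h) * b)) * ?m (l0 + h)" .
    qed (use h l0 in auto)
  qed
qed

text \<open>
  The windows start at \<open>K0\<close> because the growth estimate needs every window to contain \<open>[a, K0]\<close>.
\<close>

lemma nn_integral_exp_eq_SUP_trunc:
  "(\<integral>\<^sup>+y. ennreal (exp (l * y)) \<partial>M) = (SUP k. ennreal (trunc_mgf M (K0 + real k) l))"
proof -
  let ?f = "\<lambda>k y. ennreal (indicator {-(K0 + real k)..K0 + real k} y * exp (l * y))"
  have "(\<integral>\<^sup>+y. (SUP k. ?f k y) \<partial>M) = (SUP k. \<integral>\<^sup>+y. ?f k y \<partial>M)"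
  proof (rule nn_integral_monotone_convergence_SUP)
    show "incseq ?f"
      by (auto simp: incseq_def le_fun_def indicator_def intro!: ennreal_leI)
  qed simp
  moreover have "(SUP k. ?f k y) = ennreal (exp (l * y))" for y
  proof (rule antisym)
    show "(SUP k. ?f k y) \<le> ennreal (exp (l * y))"
      by (intro SUP_least ennreal_leI) (auto simp: indicator_def)
    obtain k where "\<bar>y\<bar> + \<bar>K0\<bar> \<le> real k" using real_arch_simple by blast
    then have "?f k y = ennreal (exp (l * y))" by (auto simp: indicator_def)
    then show "ennreal (exp (l * y)) \<le> (SUP k. ?f k y)"
      by (intro SUP_upper2[of k]) simp_all
  qed
  ultimately show ?thesis by (simp only: nn_integral_trunc_exp)
qed

text \<open>
  The sublevel sets \<open>C k\<close> of the truncated functions decrease in \<open>k\<close> and are compact. If all were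
  nonempty, a common point would be a parameter where the full integral is at most \<open>r\<close>, by monotone
  convergence.
\<close>

lemma truncation_uniform:
  assumes "0 < a" "0 < prob {a..K0}"
    and less: "\<And>l. 0 \<le> l \<Longrightarrow> ennreal r < (\<integral>\<^sup>+y. ennreal (exp (l * y)) \<partial>M)"
  obtains K where "K0 \<le> K" "\<And>l. 0 \<le> l \<Longrightarrow> r < trunc_mgf M K l"
proof -
  obtain L where L: "0 \<le> L" "\<And>K l. \<lbrakk>K0 \<le> K; 0 \<le> l; trunc_mgf M K l \<le> r\<rbrakk> \<Longrightarrow> l \<le> L"
    using bounded_sublevel_trunc_mgf[OF assms(1,2), of r] by metis
  define C where "C k = {0..L} \<inter> {l. trunc_mgf M (K0 + real k) l \<le> r}" for k
  have "\<exists>k. C k = {}"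
  proof (rule ccontr)
    assume "\<not> (\<exists>k. C k = {})"
    moreover have "compact (C k)" for k
      unfolding C_def
      by (intro compact_Int_closed closed_Collect_le continuous_trunc_mgf continuous_on_const) simp
    moreover have "C n \<subseteq> C m" if "m \<le> n" for m n
      using trunc_mgf_mono[of "K0 + real m" "K0 + real n"] that
      unfolding C_def by (auto intro: order_trans)
    ultimately have "\<Inter>(range C) \<noteq> {}" by (intro compact_nest) auto
    then obtain l where l: "\<And>k. l \<in> C k" by blast
    have "(SUP k. ennreal (trunc_mgf M (K0 + real k) l)) \<le> ennreal r"
      using l by (intro SUP_least ennreal_leI) (simp add: C_def)
    moreover have "0 \<le> l" using l[of 0] by (simp add: C_def)
    ultimately show False using less[of l] nn_integral_exp_eq_SUP_trunc[of l K0] by simp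
  qed
  then obtain k where k: "C k = {}" by blast
  show thesis
  proof (rule that[of "K0 + real k"])
    fix l :: real assume l: "0 \<le> l"
    show "r < trunc_mgf M (K0 + real k) l"
    proof (rule ccontr)
      assume "\<not> r < trunc_mgf M (K0 + real k) l"
      then have "l \<in> C k" using L(2)[of "K0 + real k" l] l by (simp add: C_def)
      then show False using k by simp
    qed
  qed simp
qed

text \<open>
  When \<open>y \<le> 0\<close> almost surely, \<open>exp (n y)\<close> tends to the indicator of \<open>{0}\<close>, dominated by \<open>1\<close>.
\<close>

lemma atom_at_zero_ge:
  assumes "emeasure M {0<..} = 0"
    and less: "\<And>l. 0 \<le> l \<Longrightarrow> c \<le> (\<integral>\<^sup>+y. ennreal (exp (l * y)) \<partial>M)"
  shows "c \<le> emeasure M {0}"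
proof -
  have ae: "AE y in M. y \<le> 0"
    using assms(1) by (subst AE_iff_measurable[of "{0<..}"]) (auto simp: not_le)
  have "(\<lambda>n. \<integral>\<^sup>+y. ennreal (exp (real n * y)) \<partial>M) \<longlonglongrightarrow> (\<integral>\<^sup>+y. indicator {0} y \<partial>M)"
  proof (rule nn_integral_dominated_convergence[where w = "\<lambda>_. 1"])
    show "AE y in M. ennreal (exp (real n * y)) \<le> 1" for n
      using ae by eventually_elim (simp add: mult_nonneg_nonpos)
    show "AE y in M. (\<lambda>n. ennreal (exp (real n * y))) \<longlonglongrightarrow> indicator {0} y"
      using ae
    proof eventually_elim
      case (elim y)
      show ?case
      proof (cases "y = 0")
        case False
        then have "(\<lambda>n. exp y ^ n) \<longlonglongrightarrow> 0" using elim by (intro LIMSEQ_realpow_zero) auto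
        then have "(\<lambda>n. ennreal (exp (real n * y))) \<longlonglongrightarrow> ennreal 0"
          by (intro tendsto_ennrealI) (simp add: exp_of_nat_mult)
        then show ?thesis using False by simp
      qed simp
    qed
    show "(\<integral>\<^sup>+ y. 1 \<partial>M) < \<infinity>" by (simp add: emeasure_eq_measure)
  qed simp_all
  then have "(\<lambda>n. \<integral>\<^sup>+y. ennreal (exp (real n * y)) \<partial>M) \<longlonglongrightarrow> emeasure M {0}"
    by simp
  then show ?thesis by (rule LIMSEQ_le_const) (use less in auto)
qed

lemma positive_mass_interval:
  assumes "emeasure M {0<..} \<noteq> 0"
  obtains a K where "0 < a" "0 < prob {a..K}"
proof (rule ccontr)
  assume "\<not> thesis"
  then have z: "prob {inverse (real (Suc k))..real k} = 0" for k
    using that[of "inverse (real (Suc k))" "real k"] measure_nonneg[of M] by (metis inverse_positive_iff_positive of_nat_0_less_iff zero_less_Suc less_eq_real_def)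
  have "{0<..} = (\<Union>k. {inverse (real (Suc k))..real k})"
  proof safe
    fix y :: real assume "0 < y"
    then obtain n where n: "inverse (real (Suc n)) < y" using reals_Archimedean by blast
    obtain m where m: "y \<le> real m" using real_arch_simple by blast
    have "inverse (real (Suc (max n m))) \<le> inverse (real (Suc n))" by (intro le_imp_inverse_le) auto
    then have "inverse (real (Suc (max n m))) \<le> y" "y \<le> real (max n m)" using n m by linarith+
    then have "y \<in> {inverse (real (Suc (max n m)))..real (max n m)}" by (rule atLeastAtMost_iff[THEN iffD2, OF conjI])
    then show "y \<in> (\<Union>k. {inverse (real (Suc k))..real k})" by blast
  next
    fix y k assume "y \<in> {inverse (real (Suc k))..real k}"
    moreover have "0 < inverse (real (Suc k))" by simp
    ultimately show "0 < y" by (meson atLeastAtMost_iff less_le_trans)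
  qed
  moreover have "emeasure M (\<Union>k. {inverse (real (Suc k))..real k}) = 0"
    by (rule emeasure_UN_eq_0) (auto simp: emeasure_eq_measure z simp del: of_nat_Suc)
  ultimately show False using assms by simp
qed

end

section \<open>Sums of independent identically distributed variables\<close>

context prob_space
begin

lemma nn_integral_prod_iid:
  fixes f :: "real \<Rightarrow> ennreal"
  assumes ind: "indep_vars (\<lambda>_. borel) Y {1..}"
    and law: "\<And>i. i \<ge> 1 \<Longrightarrow> distr M borel (Y i) = \<mu>"
    and f [measurable]: "f \<in> borel_measurable borel"
  shows "(\<integral>\<^sup>+\<omega>. (\<Prod>i=1..n. f (Y i \<omega>)) \<partial>M) = (\<integral>\<^sup>+y. f y \<partial>\<mu>) ^ n"
proof -
  have "indep_vars (\<lambda>_. borel) Y {1..n}" by (rule indep_vars_subset[OF ind]) auto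
  then have ind': "indep_vars (\<lambda>_. borel) (\<lambda>i \<omega>. f (Y i \<omega>)) {1..n}"
    by (rule indep_vars_compose2) simp
  have "(\<integral>\<^sup>+\<omega>. (\<Prod>i=1..n. f (Y i \<omega>)) \<partial>M) = (\<Prod>i=1..n. \<integral>\<^sup>+\<omega>. f (Y i \<omega>) \<partial>M)"
    by (rule indep_vars_nn_integral[OF _ ind']) auto
  also have "\<dots> = (\<Prod>i=1..n. \<integral>\<^sup>+y. f y \<partial>\<mu>)"
  proof (rule prod.cong)
    fix i assume i: "i \<in> {1..n}"
    then have "Y i \<in> borel_measurable M" using ind by (auto simp: indep_vars_def)
    then show "(\<integral>\<^sup>+\<omega>. f (Y i \<omega>) \<partial>M) = (\<integral>\<^sup>+y. f y \<partial>\<mu>)"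
      using law[of i] i by (subst law[of i, symmetric]) (auto simp: nn_integral_distr)
  qed simp
  finally show ?thesis by simp
qed

lemma chernoff_sum:
  assumes ind: "indep_vars (\<lambda>_. borel) Y {1..}"
    and law: "\<And>i. i \<ge> 1 \<Longrightarrow> distr M borel (Y i) = \<mu>"
    and l: "0 \<le> l"
  shows "emeasure M {\<omega> \<in> space M. 0 \<le> (\<Sum>i=1..n. Y i \<omega>)} \<le> (\<integral>\<^sup>+y. ennreal (exp (l * y)) \<partial>\<mu>) ^ n"
proof -
  have [measurable]: "Y i \<in> borel_measurable M" if "i \<in> {1..n}" for i
    using ind that by (auto simp: indep_vars_def)
  have "emeasure M {\<omega> \<in> space M. 0 \<le> (\<Sum>i=1..n. Y i \<omega>)}
      = (\<integral>\<^sup>+\<omega>. indicator {\<omega> \<in> space M. 0 \<le> (\<Sum>i=1..n. Y i \<omega>)} \<omega> \<partial>M)"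
    by (rule nn_integral_indicator[symmetric]) measurable
  also have "\<dots> \<le> (\<integral>\<^sup>+\<omega>. (\<Prod>i=1..n. ennreal (exp (l * Y i \<omega>))) \<partial>M)"
    using l by (intro nn_integral_mono)
      (auto simp: indicator_def prod_ennreal exp_sum[symmetric] sum_distrib_left[symmetric])
  also have "\<dots> = (\<integral>\<^sup>+y. ennreal (exp (l * y)) \<partial>\<mu>) ^ n"
    by (rule nn_integral_prod_iid[OF ind law]) simp_all
  finally show ?thesis .
qed

lemma atom_power_le:
  fixes Y :: "nat \<Rightarrow> 'a \<Rightarrow> real"
  assumes ind: "indep_vars (\<lambda>_. borel) Y {1..}"
    and law: "\<And>i. i \<ge> 1 \<Longrightarrow> distr M borel (Y i) = \<mu>"
  shows "emeasure \<mu> {0} ^ n \<le> emeasure M {\<omega> \<in> space M. 0 \<le> (\<Sum>i=1..n. Y i \<omega>)}"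
proof -
  have [measurable]: "Y i \<in> borel_measurable M" if "i \<in> {1..n}" for i
    using ind that by (auto simp: indep_vars_def)
  have "sets \<mu> = sets borel" unfolding law[of 1, OF order_refl, symmetric] by simp
  then have "(\<integral>\<^sup>+y. indicator {0} y \<partial>\<mu>) = emeasure \<mu> {0}"
    by (intro nn_integral_indicator) simp
  then have "emeasure \<mu> {0} ^ n = (\<integral>\<^sup>+y. indicator {0} y \<partial>\<mu>) ^ n"
    by (simp only:)
  also have "\<dots> = (\<integral>\<^sup>+\<omega>. (\<Prod>i=1..n. indicator {0} (Y i \<omega>)) \<partial>M)"
    by (rule nn_integral_prod_iid[OF ind law, symmetric]) simp_all
  also have "\<dots> \<le> (\<integral>\<^sup>+\<omega>. indicator {\<omega> \<in> space M. 0 \<le> (\<Sum>i=1..n. Y i \<omega>)} \<omega> \<partial>M)"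
  proof (rule nn_integral_mono)
    fix \<omega> assume \<omega>: "\<omega> \<in> space M"
    show "(\<Prod>i=1..n. indicator {0} (Y i \<omega>) :: ennreal)
        \<le> indicator {\<omega> \<in> space M. 0 \<le> (\<Sum>i=1..n. Y i \<omega>)} \<omega>"
    proof (cases "\<forall>i\<in>{1..n}. Y i \<omega> = 0")
      case True
      then show ?thesis using \<omega> by simp
    next
      case False
      then have "(\<Prod>i=1..n. indicator {0} (Y i \<omega>) :: ennreal) = 0"
        by (intro prod_zero) (auto simp: indicator_def)
      then show ?thesis by (simp only: zero_le)
    qed
  qed
  also have "\<dots> = emeasure M {\<omega> \<in> space M. 0 \<le> (\<Sum>i=1..n. Y i \<omega>)}"
    by (rule nn_integral_indicator) measurable
  finally show ?thesis .
qed

text \<open>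
  On the event that all \<open>Y i\<close> lie in the window, with \<open>s\<close> their sum and \<open>t = n b\<close>, the pointwise
  inequality \<open>exp (\<beta> (s - t)) \<le> 1[s \<ge> 0] + exp (\<alpha> s - \<beta> t) + exp (\<gamma> (s - t))\<close> holds: the second
  term dominates when \<open>s < 0\<close>, the third when \<open>s > t\<close>, and in between the left side is at most \<open>1\<close>.
  Off that event the left side carries the weight \<open>0\<close>.
\<close>

lemma tilted_lower_bound:
  assumes ind: "indep_vars (\<lambda>_. borel) Y {1..}"
    and law: "\<And>i. i \<ge> 1 \<Longrightarrow> distr M borel (Y i) = \<mu>"
    and ord: "0 \<le> \<alpha>" "\<alpha> \<le> \<beta>" "\<beta> \<le> \<gamma>"
  shows "(exp (- (\<beta> * b)) * trunc_mgf \<mu> K \<beta>) ^ n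
    \<le> measure M {\<omega> \<in> space M. 0 \<le> (\<Sum>i=1..n. Y i \<omega>)}
      + (exp (- (\<beta> * b)) * trunc_mgf \<mu> K \<alpha>) ^ n + (exp (- (\<gamma> * b)) * trunc_mgf \<mu> K \<gamma>) ^ n"
proof -
  have [measurable]: "Y i \<in> borel_measurable M" if "i \<in> {1..n}" for i
    using ind that by (auto simp: indep_vars_def)
  have "Y 1 \<in> borel_measurable M" using ind by (auto simp: indep_vars_def)
  then interpret \<mu>: real_distribution \<mu>
    using law[of 1] real_distribution_distr by fastforce
  \<comment> \<open>The factor \<open>exp (- \<theta> b)\<close> is spread over the \<open>n\<close> variables, so that each term is a product.\<close>
  define w where "w \<theta> \<eta> y = ennreal (exp (- (\<theta> * b)) * (indicator {-K..K} y * exp (\<eta> * y)))" for \<theta> \<eta> y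
  define A where "A = {\<omega> \<in> space M. 0 \<le> (\<Sum>i=1..n. Y i \<omega>)}"
  have [measurable]: "w \<theta> \<eta> \<in> borel_measurable borel" for \<theta> \<eta>
    unfolding w_def by measurable
  have tm_nonneg: "0 \<le> trunc_mgf \<mu> K \<eta>" for \<eta>
    unfolding trunc_mgf_def by (rule integral_nonneg_AE) simp
  have int: "(\<integral>\<^sup>+\<omega>. (\<Prod>i=1..n. w \<theta> \<eta> (Y i \<omega>)) \<partial>M) = ennreal ((exp (- (\<theta> * b)) * trunc_mgf \<mu> K \<eta>) ^ n)" for \<theta> \<eta>
  proof -
    have "(\<integral>\<^sup>+\<omega>. (\<Prod>i=1..n. w \<theta> \<eta> (Y i \<omega>)) \<partial>M) = (\<integral>\<^sup>+y. w \<theta> \<eta> y \<partial>\<mu>) ^ n"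
      by (rule nn_integral_prod_iid[OF ind law]) simp_all
    also have "(\<integral>\<^sup>+y. w \<theta> \<eta> y \<partial>\<mu>) = ennreal (exp (- (\<theta> * b)) * trunc_mgf \<mu> K \<eta>)"
    proof -
      have "(\<integral>\<^sup>+y. w \<theta> \<eta> y \<partial>\<mu>)
          = (\<integral>\<^sup>+y. ennreal (exp (- (\<theta> * b))) * ennreal (indicator {-K..K} y * exp (\<eta> * y)) \<partial>\<mu>)"
        unfolding w_def by (intro nn_integral_cong ennreal_mult) auto
      also have "\<dots> = ennreal (exp (- (\<theta> * b))) * ennreal (trunc_mgf \<mu> K \<eta>)"
        by (subst nn_integral_cmult) (simp, simp only: \<mu>.nn_integral_trunc_exp)
      finally show ?thesis by (simp add: ennreal_mult tm_nonneg)
    qed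
    finally show ?thesis by (simp add: ennreal_power tm_nonneg)
  qed
  have pw: "(\<Prod>i=1..n. w \<beta> \<beta> (Y i \<omega>))
      \<le> indicator A \<omega> + (\<Prod>i=1..n. w \<beta> \<alpha> (Y i \<omega>)) + (\<Prod>i=1..n. w \<gamma> \<gamma> (Y i \<omega>))"
    if \<omega>: "\<omega> \<in> space M" for \<omega>
  proof (cases "\<forall>i\<in>{1..n}. Y i \<omega> \<in> {-K..K}")
    case True
    define s where "s = (\<Sum>i=1..n. Y i \<omega>)"
    define t where "t = real n * b"
    have prod: "(\<Prod>i=1..n. w \<theta> \<eta> (Y i \<omega>)) = ennreal (exp (\<eta> * s - \<theta> * t))" for \<theta> \<eta>
    proof -
      have "(\<Prod>i=1..n. w \<theta> \<eta> (Y i \<omega>)) = (\<Prod>i=1..n. ennreal (exp (\<eta> * Y i \<omega> - \<theta> * b)))"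
        using True by (intro prod.cong) (auto simp: w_def exp_add[symmetric] exp_diff exp_minus field_simps)
      also have "\<dots> = ennreal (exp (\<Sum>i=1..n. \<eta> * Y i \<omega> - \<theta> * b))"
        by (simp add: prod_ennreal exp_sum)
      also have "(\<Sum>i=1..n. \<eta> * Y i \<omega> - \<theta> * b) = \<eta> * s - \<theta> * t"
        by (simp add: sum_subtractf sum_distrib_left s_def t_def)
      finally show ?thesis .
    qed
    have "exp (\<beta> * s - \<beta> * t) \<le> indicator A \<omega> + exp (\<alpha> * s - \<beta> * t) + exp (\<gamma> * s - \<gamma> * t)"
    proof -
      consider "s < 0" | "s \<ge> 0" "s \<le> t" | "s > t" by linarith
      then show ?thesis
      proof cases
        case 1
        then have "\<beta> * s \<le> \<alpha> * s" using ord by (simp add: mult_right_mono_neg)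
        then show ?thesis by (intro add_increasing2 add_increasing) auto
      next
        case 2
        then have "\<omega> \<in> A" using \<omega> by (simp add: A_def s_def)
        moreover have "\<beta> * s \<le> \<beta> * t" using 2 ord by (simp add: mult_left_mono)
        then have "exp (\<beta> * s - \<beta> * t) \<le> 1" by simp
        ultimately show ?thesis by (intro add_increasing2) auto
      next
        case 3
        then have "\<beta> * (s - t) \<le> \<gamma> * (s - t)" using ord by (intro mult_right_mono) auto
        then show ?thesis by (intro add_increasing) (auto simp: algebra_simps)
      qed
    qed
    then have "ennreal (exp (\<beta> * s - \<beta> * t))
        \<le> ennreal (indicator A \<omega> + exp (\<alpha> * s - \<beta> * t) + exp (\<gamma> * s - \<gamma> * t))"
      by (rule ennreal_leI)
    then show ?thesis unfolding prod by (simp add: ennreal_plus ennreal_indicator)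
  next
    case False
    then have "(\<Prod>i=1..n. w \<beta> \<beta> (Y i \<omega>)) = 0"
      by (intro prod_zero) (auto simp: w_def indicator_def)
    then show ?thesis by (simp only: zero_le)
  qed
  have [measurable]: "A \<in> sets M" unfolding A_def by measurable
  have "ennreal ((exp (- (\<beta> * b)) * trunc_mgf \<mu> K \<beta>) ^ n)
     \<le> (\<integral>\<^sup>+\<omega>. indicator A \<omega> + (\<Prod>i=1..n. w \<beta> \<alpha> (Y i \<omega>)) + (\<Prod>i=1..n. w \<gamma> \<gamma> (Y i \<omega>)) \<partial>M)"
    unfolding int[symmetric] by (rule nn_integral_mono) (rule pw)
  also have "\<dots> = ennreal (measure M A) + ennreal ((exp (- (\<beta> * b)) * trunc_mgf \<mu> K \<alpha>) ^ n)
      + ennreal ((exp (- (\<gamma> * b)) * trunc_mgf \<mu> K \<gamma>) ^ n)"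
    unfolding int[symmetric] by (simp add: nn_integral_add emeasure_eq_measure)
  also have "\<dots> = ennreal (measure M A + (exp (- (\<beta> * b)) * trunc_mgf \<mu> K \<alpha>) ^ n
      + (exp (- (\<gamma> * b)) * trunc_mgf \<mu> K \<gamma>) ^ n)"
    by (simp add: ennreal_plus tm_nonneg)
  finally show ?thesis
    unfolding A_def by (subst (asm) ennreal_le_iff) (auto simp: tm_nonneg)
qed

end

lemma eventually_three_powers_le:
  fixes q r u v :: real
  assumes "0 \<le> r" "r < q" "0 \<le> u" "u < q" "0 \<le> v" "v < q"
  shows "eventually (\<lambda>n. r ^ n + u ^ n + v ^ n \<le> q ^ n) sequentially"
proof -
  have q: "0 < q" using assms by linarith
  have z: "(\<lambda>n. (z / q) ^ n) \<longlonglongrightarrow> 0" if "0 \<le> z" "z < q" for z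
    using that q by (intro LIMSEQ_realpow_zero) auto
  have "(\<lambda>n. (r / q) ^ n + (u / q) ^ n + (v / q) ^ n) \<longlonglongrightarrow> 0 + 0 + 0"
    using assms by (intro tendsto_add z)
  then have "eventually (\<lambda>n. (r / q) ^ n + (u / q) ^ n + (v / q) ^ n < 1) sequentially"
    by (intro order_tendstoD(2)) auto
  then show ?thesis
    by eventually_elim (use q in \<open>simp add: power_divide add_divide_distrib[symmetric]\<close>)
qed

lemma (in prob_space) lower_bound_sum:
  assumes ind: "indep_vars (\<lambda>_. borel) Y {1..}"
    and law: "\<And>i. i \<ge> 1 \<Longrightarrow> distr M borel (Y i) = \<mu>"
    and r: "0 < r"
    and less: "\<And>l. 0 \<le> l \<Longrightarrow> ennreal r < (\<integral>\<^sup>+y. ennreal (exp (l * y)) \<partial>\<mu>)"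
  shows "eventually (\<lambda>n. ennreal r ^ n \<le> emeasure M {\<omega> \<in> space M. 0 \<le> (\<Sum>i=1..n. Y i \<omega>)}) sequentially"
proof -
  have "Y 1 \<in> borel_measurable M" using ind by (auto simp: indep_vars_def)
  then interpret \<mu>: real_distribution \<mu>
    using law[of 1] real_distribution_distr by fastforce
  show ?thesis
  proof (cases "emeasure \<mu> {0<..} = 0")
    case True
    then have "ennreal r \<le> emeasure \<mu> {0}"
      by (rule \<mu>.atom_at_zero_ge) (use less in \<open>auto intro: less_imp_le\<close>)
    then have "ennreal r ^ n \<le> emeasure \<mu> {0} ^ n" for n by (rule power_mono) simp
    then show ?thesis
      using atom_power_le[OF ind law] by (intro always_eventually allI) (rule order_trans)
  next
    case False
    then obtain a K0 where a: "0 < a" "0 < measure \<mu> {a..K0}"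
      using \<mu>.positive_mass_interval by blast
    obtain K where K: "K0 \<le> K" "\<And>l. 0 \<le> l \<Longrightarrow> r < trunc_mgf \<mu> K l"
      using \<mu>.truncation_uniform[OF a less] by blast
    have "measure \<mu> {a..K0} \<le> measure \<mu> {a..K}"
      using K(1) by (intro \<mu>.finite_measure_mono) auto
    then have a': "0 < measure \<mu> {a..K}" using a by linarith
    obtain \<alpha> \<beta> \<gamma> b where t: "0 \<le> \<alpha>" "\<alpha> \<le> \<beta>" "\<beta> \<le> \<gamma>"
      "r < exp (- (\<beta> * b)) * trunc_mgf \<mu> K \<beta>"
      "exp (- (\<beta> * b)) * trunc_mgf \<mu> K \<alpha> < exp (- (\<beta> * b)) * trunc_mgf \<mu> K \<beta>"
      "exp (- (\<gamma> * b)) * trunc_mgf \<mu> K \<gamma> < exp (- (\<beta> * b)) * trunc_mgf \<mu> K \<beta>"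
      using \<mu>.exists_tilt[OF a(1) a' r K(2)] by metis
    have nn: "0 \<le> exp c * trunc_mgf \<mu> K l" for c l
      unfolding trunc_mgf_def by (intro mult_nonneg_nonneg integral_nonneg_AE) auto
    have "eventually (\<lambda>n. r ^ n + (exp (- (\<beta> * b)) * trunc_mgf \<mu> K \<alpha>) ^ n
        + (exp (- (\<gamma> * b)) * trunc_mgf \<mu> K \<gamma>) ^ n
        \<le> (exp (- (\<beta> * b)) * trunc_mgf \<mu> K \<beta>) ^ n) sequentially"
      using r t nn by (intro eventually_three_powers_le) auto
    then show ?thesis
    proof eventually_elim
      case (elim n)
      then have "r ^ n \<le> measure M {\<omega> \<in> space M. 0 \<le> (\<Sum>i=1..n. Y i \<omega>)}"
        using tilted_lower_bound[OF ind law t(1-3), of b K n] by linarith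
      then show ?case using r by (simp add: emeasure_eq_measure ennreal_power)
    qed
  qed
qed

section \<open>Passage to extended logarithms\<close>

lemma ext_log_le_scaled:
  assumes "0 < n" "p \<le> q ^ n"
  shows "ereal (1 / real n) * ext_log p \<le> ext_log q"
proof (cases "p = 0 \<or> q = \<infinity>")
  case True
  then show ?thesis using assms by (auto simp: ext_log_def)
next
  case False
  then have q: "q \<noteq> 0" using assms by (auto simp: power_0_left)
  have "q < \<infinity>" using False by (simp add: less_top)
  then obtain q' where q': "q = ennreal q'" "0 < q'"
    using q by (cases q) (auto simp: less_le)
  have "p \<le> ennreal (q' ^ n)" using assms q' by (simp add: ennreal_power)
  then have "p < \<infinity>" using ennreal_less_top le_less_trans infinity_ennreal_def by metis
  then obtain p' where p': "p = ennreal p'" "0 < p'"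
    using False by (cases p) (auto simp: less_le)
  have "p' \<le> q' ^ n" using \<open>p \<le> ennreal (q' ^ n)\<close> p' q' by simp
  then have "ln p' \<le> ln (q' ^ n)" using p' q' by (subst ln_le_cancel_iff) auto
  then have "ln p' \<le> real n * ln q'" using q' by (simp add: ln_realpow)
  then show ?thesis using assms p' q' by (simp add: ext_log_def field_simps)
qed

lemma ext_log_ge_scaled:
  assumes "0 < n" "ennreal (exp t) ^ n \<le> p"
  shows "ereal t \<le> ereal (1 / real n) * ext_log p"
proof (cases "p = \<infinity>")
  case True
  then show ?thesis using assms by (simp add: ext_log_def)
next
  case False
  have le: "ennreal (exp (real n * t)) \<le> p" using assms by (simp add: ennreal_power exp_of_nat_mult)
  then have "0 < p" by (metis ennreal_less_zero_iff exp_gt_zero less_le_trans)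
  then obtain p' where p': "p = ennreal p'" "0 < p'"
    using False by (cases p) (auto simp: less_le)
  then have "exp (real n * t) \<le> p'" using le by simp
  then have "real n * t \<le> ln p'" using p' by (simp add: ln_ge_iff)
  then show ?thesis using assms p' by (simp add: ext_log_def field_simps)
qed

lemma less_ext_log_imp:
  assumes "ereal t < ext_log q"
  shows "ennreal (exp t) < q"
proof (cases "q = 0 \<or> q = \<infinity>")
  case True
  then show ?thesis using assms by (auto simp: ext_log_def)
next
  case False
  then obtain q' where q': "q = ennreal q'" "0 < q'"
    by (cases q) (auto simp: less_le)
  then have "t < ln q'" using assms by (simp add: ext_log_def)
  then have "exp t < q'" using q' by (metis exp_less_mono exp_ln)
  then show ?thesis using q' by (simp add: ennreal_less_iff)
qed

text \<open>
  This absorbs the term \<open>- l x\<close> into the law of \<open>X - x\<close>, also where the expectation is infinite.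
\<close>

lemma ext_log_exp_mult: "ext_log (ennreal (exp t) * q) = ext_log q + ereal t"
proof (cases "q = 0 \<or> q = \<infinity>")
  case True
  then show ?thesis by (auto simp: ext_log_def ennreal_mult_eq_top_iff)
next
  case False
  then obtain q' where q': "q = ennreal q'" "0 < q'"
    by (cases q) (auto simp: less_le)
  then show ?thesis
    by (simp add: ext_log_def ennreal_mult[symmetric] ln_mult)
qed

theorem mainTheorem1:
  fixes M :: "'a measure" and X :: "nat \<Rightarrow> 'a \<Rightarrow> real" and x :: real
  assumes "prob_space M"
    and "prob_space.indep_vars M (\<lambda>_. borel) X {1..}"
    and "\<And>i. i \<ge> 1 \<Longrightarrow> distr M borel (X i) = distr M borel (X 1)"
  shows "\<exists>L \<in> {-\<infinity>..0::ereal}.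
    (\<lambda>n. ereal (1 / real n) * ext_log (emeasure M {\<omega> \<in> space M. empirical_mean X n \<omega> \<ge> x}))
        \<longlonglongrightarrow> L
    \<and> L = (INF l\<in>{0::real..}.
          ext_log (\<integral>\<^sup>+ \<omega>. ennreal (exp (l * X 1 \<omega>)) \<partial>M) - ereal (l * x))"
proof -
  interpret prob_space M by fact
  define Y where "Y i \<omega> = X i \<omega> - x" for i \<omega>
  define \<mu> where "\<mu> = distr M borel (Y 1)"
  define mgf where "mgf l = (\<integral>\<^sup>+y. ennreal (exp (l * y)) \<partial>\<mu>)" for l
  define p where "p n = emeasure M {\<omega> \<in> space M. empirical_mean X n \<omega> \<ge> x}" for n
  have X [measurable]: "X i \<in> borel_measurable M" if "i \<ge> 1" for i
    using assms(2) that by (auto simp: indep_vars_def)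
  have X1 [measurable]: "X 1 \<in> borel_measurable M" "X (Suc 0) \<in> borel_measurable M" using X by auto
  have ind: "indep_vars (\<lambda>_. borel) Y {1..}"
    unfolding Y_def by (rule indep_vars_compose2[OF assms(2)]) simp
  have law: "distr M borel (Y i) = \<mu>" if "i \<ge> 1" for i
  proof -
    have shift: "distr M borel (Y j) = distr (distr M borel (X j)) borel (\<lambda>y. y - x)" if "j \<ge> 1" for j
      using X[OF that] by (subst distr_distr) (auto simp: comp_def Y_def[abs_def])
    show ?thesis unfolding \<mu>_def using shift[OF that] shift[of 1] assms(3)[OF that] by simp
  qed
  have p: "p n = emeasure M {\<omega> \<in> space M. 0 \<le> (\<Sum>i=1..n. Y i \<omega>)}" if "0 < n" for n
    using that unfolding p_def
    by (intro arg_cong[where f = "emeasure M"] Collect_cong conj_cong refl)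
      (simp add: empirical_mean_def Y_def sum_subtractf field_simps)
  have mgf: "ext_log (\<integral>\<^sup>+ \<omega>. ennreal (exp (l * X 1 \<omega>)) \<partial>M) - ereal (l * x) = ext_log (mgf l)" for l
  proof -
    have "mgf l = (\<integral>\<^sup>+\<omega>. ennreal (exp (l * (X 1 \<omega> - x))) \<partial>M)"
      unfolding mgf_def \<mu>_def Y_def[abs_def] by (subst nn_integral_distr) auto
    also have "\<dots> = (\<integral>\<^sup>+\<omega>. ennreal (exp (- (l * x))) * ennreal (exp (l * X 1 \<omega>)) \<partial>M)"
      by (simp add: ennreal_mult[symmetric] exp_add[symmetric] algebra_simps)
    also have "\<dots> = ennreal (exp (- (l * x))) * (\<integral>\<^sup>+\<omega>. ennreal (exp (l * X 1 \<omega>)) \<partial>M)"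
      by (rule nn_integral_cmult) simp
    finally show ?thesis by (simp add: ext_log_exp_mult minus_ereal_def)
  qed
  define L where "L = (INF l\<in>{0::real..}. ext_log (mgf l))"
  have upper: "ereal (1 / real n) * ext_log (p n) \<le> L" if "0 < n" for n
    unfolding L_def
  proof (rule INF_greatest)
    fix l :: real assume "l \<in> {0..}"
    then have "p n \<le> mgf l ^ n"
      unfolding p[OF that] mgf_def by (intro chernoff_sum[OF ind law]) auto
    then show "ereal (1 / real n) * ext_log (p n) \<le> ext_log (mgf l)"
      by (rule ext_log_le_scaled[OF that])
  qed
  have lower: "eventually (\<lambda>n. ereal t \<le> ereal (1 / real n) * ext_log (p n)) sequentially"
    if t: "ereal t < L" for t
  proof -
    have "ennreal (exp t) < mgf l" if "0 \<le> l" for l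
      using that by (intro less_ext_log_imp less_le_trans[OF t]) (auto simp: L_def intro: INF_lower)
    then have "eventually (\<lambda>n. ennreal (exp t) ^ n
        \<le> emeasure M {\<omega> \<in> space M. 0 \<le> (\<Sum>i=1..n. Y i \<omega>)}) sequentially"
      unfolding mgf_def by (intro lower_bound_sum[OF ind law]) auto
    then show ?thesis
      using eventually_gt_at_top[of 0]
      by eventually_elim (auto intro!: ext_log_ge_scaled simp: p)
  qed
  have "(\<lambda>n. ereal (1 / real n) * ext_log (p n)) \<longlonglongrightarrow> L"
  proof (rule order_tendstoI)
    fix c assume "c < L"
    then obtain t where t: "c < ereal t" "ereal t < L" using ereal_dense2 by blast
    show "eventually (\<lambda>n. c < ereal (1 / real n) * ext_log (p n)) sequentially"
      using lower[OF t(2)] by eventually_elim (rule less_le_trans[OF t(1)])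
  next
    fix c assume "L < c"
    then show "eventually (\<lambda>n. ereal (1 / real n) * ext_log (p n) < c) sequentially"
      by (intro eventually_mono[OF eventually_gt_at_top[of 0]]) (meson upper le_less_trans)
  qed
  moreover have "L \<le> 0"
  proof -
    have "L \<le> ext_log (mgf 0)" unfolding L_def by (rule INF_lower) simp
    also have "mgf 0 = 1"
      unfolding mgf_def \<mu>_def Y_def[abs_def] by (subst nn_integral_distr) (auto simp: emeasure_space_1)
    also have "ext_log 1 = 0" by (simp add: ext_log_def)
    finally show ?thesis .
  qed
  ultimately show ?thesis
    unfolding mgf p_def[symmetric] L_def[symmetric] by auto
qed

end
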